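(* Let $d>2$ and let $\Sigma\subset\mathbb{R}^d$ be a $C^2$-smooth strictly convex hypersurface with strictly positive curvature at every point. There exists a constant $C(\Sigma)>0$ such that for every maximizing billiard configuration $\{x_n\}$ in $\Sigma$ (finite segment or infinite) the angle of reflection $\varphi_n$ at any vertex $x_n$ (at which a reflection takes place, i.e. having both neighbours $x_{n-1},x_{n+1}$ in the configuration) satisfies $$\varphi_n>C(\Sigma).$$
   Context: $\Sigma$ is the (compact) boundary of the convex billiard table in $\mathbb{R}^d$; positive curvature means that the second fundamental form with respect to the inward unit normal is positive definite at every point. Let $L(x,y)=|x-y|$ be the Euclidean distance. A billiard configuration is a sequence of points $x_n\in\Sigma$ (indexed by an interval of integers, finite or infinite), with $x_n\ne x_{n+1}$, which obeys the billiard reflection law at every point having both neighbours; equivalently, for all integers $M\le N$ such that $M-1,\dots,N+1$ lie in the index set, $(x_M,\dots,x_N)$ is a critical point of the function $$\Phi_{M,N}(u_M,\dots,u_N)=L(x_{M-1},u_M)+\sum_{i=M}^{N-1}L(u_i,u_{i+1})+L(u_N,x_{N+1})$$ of $(u_M,\dots,u_N)\in\Sigma^{N-M+1}$. A finite segment $\{x_n\}_{n\in[M,N]}$ of a billiard configuration ($N\ge M+2$) is called maximizing if $(x_{M+1},\dots,x_{N-1})$ is a local maximum of the function $\Phi_{M+1,N-1}$ (with $x_M,x_N$ fixed). An infinite configuration is called maximizing if every finite segment of it is maximizing. The angle of reflection $\varphi_n\in(0,\pi/2]$ at $x_n$ is the angle between the vector $x_{n+1}-x_n$ and the tangent hyperplane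 $T_{x_n}\Sigma$. *)

theory Defs
  imports "HOL-Analysis.Analysis"
begin

text \<open>The billiard table \<open>K\<close> is a convex body; the hypersurface is its boundary \<open>frontier K\<close>.\<close>

definition strictly_convex_body :: "'a::euclidean_space set \<Rightarrow> bool" where
  "strictly_convex_body K \<longleftrightarrow>
     compact K \<and> convex K \<and> interior K \<noteq> {} \<and>
     (\<forall>x\<in>K. \<forall>y\<in>K. x \<noteq> y \<longrightarrow> open_segment x y \<subseteq> interior K)"

definition C2_on :: "('a::euclidean_space \<Rightarrow> real) \<Rightarrow> 'a set \<Rightarrow> bool" where
  "C2_on f U \<longleftrightarrow>
     (\<exists>(f' :: 'a \<Rightarrow> 'a \<Rightarrow>\<^sub>L real) (f'' :: 'a \<Rightarrow> 'a \<Rightarrow>\<^sub>L ('a \<Rightarrow>\<^sub>L real)).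
        (\<forall>x\<in>U. (f has_derivative blinfun_apply (f' x)) (at x)) \<and>
        (\<forall>x\<in>U. (f' has_derivative blinfun_apply (f'' x)) (at x)) \<and>
        continuous_on U f'')"

definition C2_hypersurface :: "'a::euclidean_space set \<Rightarrow> bool" where
  "C2_hypersurface S \<longleftrightarrow>
     (\<forall>p\<in>S. \<exists>U f. open U \<and> p \<in> U \<and> C2_on f U \<and>
        frechet_derivative f (at p) \<noteq> (\<lambda>_. 0) \<and>
        S \<inter> U = {x \<in> U. f x = 0})"

text \<open>Only the germ of the curve at \<open>0\<close> matters: it has to lie in \<open>S\<close> near time \<open>0\<close> and to be
  differentiable at \<open>0\<close>.\<close>

definition curve_in :: "'a::euclidean_space set \<Rightarrow> 'a \<Rightarrow> 'a \<Rightarrow> (real \<Rightarrow> 'a) \<Rightarrow> bool" where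
  "curve_in S p v \<gamma> \<longleftrightarrow>
     \<gamma> 0 = p \<and> (\<forall>\<^sub>F t in nhds 0. \<gamma> t \<in> S) \<and> (\<gamma> has_vector_derivative v) (at 0)"

definition tangent_space :: "'a::euclidean_space set \<Rightarrow> 'a \<Rightarrow> 'a set" where
  "tangent_space S p = {v. \<exists>\<gamma>. curve_in S p v \<gamma>}"

definition inward_unit_normal :: "'a::euclidean_space set \<Rightarrow> 'a \<Rightarrow> 'a" where
  "inward_unit_normal K p =
     (THE \<nu>. norm \<nu> = 1 \<and> (\<forall>v\<in>tangent_space (frontier K) p. v \<bullet> \<nu> = 0) \<and>
        (\<forall>\<^sub>F t in at_right 0. p + t *\<^sub>R \<nu> \<in> interior K))"

text \<open>\<open>II\<^sub>p(v, w) = - (d\<nu>\<^sub>p v) \<bullet> w\<close> for \<open>v\<close>, \<open>w\<close> tangent at \<open>p\<close>, where \<open>\<nu>\<close> is the inward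
  unit normal field along the hypersurface. A derivative within the hypersurface is not unique as
  a linear map on the ambient space, but its values on tangent vectors are, so the arbitrary choice
  made by \<open>frechet_derivative\<close> is immaterial. With this sign the unit sphere has
  \<open>II\<^sub>p(v, v) = v \<bullet> v\<close>.\<close>

definition second_fundamental_form :: "'a::euclidean_space set \<Rightarrow> 'a \<Rightarrow> 'a \<Rightarrow> 'a \<Rightarrow> real" where
  "second_fundamental_form K p v w =
     - (frechet_derivative (inward_unit_normal K) (at p within frontier K) v \<bullet> w)"

definition positively_curved :: "'a::euclidean_space set \<Rightarrow> bool" where
  "positively_curved K \<longleftrightarrow>
     (\<forall>p\<in>frontier K. \<forall>v\<in>tangent_space (frontier K) p. v \<noteq> 0 \<longrightarrow>
        second_fundamental_form K p v v > 0)"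

text \<open>Tuples \<open>(u\<^sub>M, \<dots>, u\<^sub>N)\<close> are represented by functions on the integers, of which only the values
  on \<open>{M..N}\<close> are used. The end points \<open>x\<^sub>M\<^sub>-\<^sub>1\<close> and \<open>x\<^sub>N\<^sub>+\<^sub>1\<close> are taken from \<open>x\<close>.\<close>

definition Phi :: "(int \<Rightarrow> 'a::euclidean_space) \<Rightarrow> int \<Rightarrow> int \<Rightarrow> (int \<Rightarrow> 'a) \<Rightarrow> real" where
  "Phi x M N u =
     dist (x (M - 1)) (u M) + (\<Sum>i\<in>{M..N-1}. dist (u i) (u (i + 1))) + dist (u N) (x (N + 1))"

text \<open>The differential on the product manifold vanishes, i.e. the derivative along every tuple of
  curves in \<open>S\<close> does.\<close>

definition critical_on ::
    "'a::euclidean_space set \<Rightarrow> int \<Rightarrow> int \<Rightarrow> ((int \<Rightarrow> 'a) \<Rightarrow> real) \<Rightarrow> (int \<Rightarrow> 'a) \<Rightarrow> bool" where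
  "critical_on S M N F x \<longleftrightarrow>
     (\<forall>v \<gamma>. (\<forall>i\<in>{M..N}. curve_in S (x i) (v i) (\<gamma> i)) \<longrightarrow>
        ((\<lambda>t. F (\<lambda>i. \<gamma> i t)) has_real_derivative 0) (at 0))"

definition local_max_on ::
    "'a::euclidean_space set \<Rightarrow> int \<Rightarrow> int \<Rightarrow> ((int \<Rightarrow> 'a) \<Rightarrow> real) \<Rightarrow> (int \<Rightarrow> 'a) \<Rightarrow> bool" where
  "local_max_on S M N F x \<longleftrightarrow>
     (\<exists>\<epsilon>>0. \<forall>u. (\<forall>i\<in>{M..N}. u i \<in> S \<and> dist (u i) (x i) < \<epsilon>) \<longrightarrow> F u \<le> F x)"

definition billiard_configuration ::
    "'a::euclidean_space set \<Rightarrow> int set \<Rightarrow> (int \<Rightarrow> 'a) \<Rightarrow> bool" where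
  "billiard_configuration S I x \<longleftrightarrow>
     (\<forall>a\<in>I. \<forall>b\<in>I. {a..b} \<subseteq> I) \<and>
     (\<forall>n\<in>I. x n \<in> S) \<and>
     (\<forall>n. n \<in> I \<and> n + 1 \<in> I \<longrightarrow> x n \<noteq> x (n + 1)) \<and>
     (\<forall>M N. M \<le> N \<and> {M-1..N+1} \<subseteq> I \<longrightarrow> critical_on S M N (Phi x M N) x)"

definition maximizing_segment ::
    "'a::euclidean_space set \<Rightarrow> int \<Rightarrow> int \<Rightarrow> (int \<Rightarrow> 'a) \<Rightarrow> bool" where
  "maximizing_segment S M N x \<longleftrightarrow>
     M + 2 \<le> N \<and> local_max_on S (M + 1) (N - 1) (Phi x (M + 1) (N - 1)) x"

text \<open>A finite configuration is itself one segment; an infinite one, possibly only one-sided, is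
  maximizing if all its finite segments are.\<close>

definition maximizing_configuration ::
    "'a::euclidean_space set \<Rightarrow> int set \<Rightarrow> (int \<Rightarrow> 'a) \<Rightarrow> bool" where
  "maximizing_configuration S I x \<longleftrightarrow>
     billiard_configuration S I x \<and>
     (if finite I then \<exists>M N. I = {M..N} \<and> maximizing_segment S M N x
      else \<forall>M N. M + 2 \<le> N \<and> {M..N} \<subseteq> I \<longrightarrow> maximizing_segment S M N x)"

text \<open>The angle between a vector and a linear subspace is the least angle that the vector makes with
  a nonzero vector of the subspace.\<close>

definition angle_to_subspace :: "'a::euclidean_space \<Rightarrow> 'a set \<Rightarrow> real" where
  "angle_to_subspace w T = (INF v\<in>T - {0}. arccos ((w \<bullet> v) / (norm w * norm v)))"

definition reflection_angle ::
    "'a::euclidean_space set \<Rightarrow> (int \<Rightarrow> 'a) \<Rightarrow> int \<Rightarrow> real" where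
  "reflection_angle S x n = angle_to_subspace (x (n + 1) - x n) (tangent_space S (x n))"

end

theory Submission imports Defs begin

text \<open>
  Let \<open>p = x\<^sub>n\<close> be a vertex, \<open>\<nu>\<close> the inner unit normal at \<open>p\<close>, and \<open>e\<close>, \<open>e'\<close> the unit vectors from \<open>p\<close>
  towards its two neighbours. By the reflection law \<open>e + e'\<close> is normal to the hypersurface, so \<open>e\<close>
  and \<open>e'\<close> make the same angle \<open>\<phi>\<close> with the tangent hyperplane. As the dimension exceeds two, there
  is a unit tangent vector \<open>v\<close> orthogonal to \<open>e\<close>, hence also to \<open>e'\<close>. Move \<open>p\<close> along the hypersurface
  in this direction, to \<open>u = p + t v + a \<nu>\<close>; bounded curvature means \<open>0 \<le> a \<le> k t\<^sup>2\<close> with \<open>k\<close>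
  depending only on the body. A neighbour at distance \<open>l\<close> from \<open>p\<close> has squared distance
  \<open>l\<^sup>2 + t\<^sup>2 + a\<^sup>2 - 2 a l sin \<phi>\<close> from \<open>u\<close>: the sideways motion gains \<open>t\<^sup>2\<close>, while bending inwards
  costs at most \<open>2 k t\<^sup>2 l sin \<phi>\<close>. If \<open>2 k D sin \<phi> < 1\<close>, with \<open>D\<close> a bound for the diameter, both
  legs become longer, for arbitrarily small \<open>t\<close>. This contradicts maximality, because a local
  maximum of the length of a polygon is one also in each vertex separately
  (\<open>local_max_single_vertex\<close>). So \<open>sin \<phi> \<ge> 1 / (2 k D)\<close>; this is
  \<open>locally_longest_path_is_steep\<close>.

  The constant \<open>k\<close> comes from a Taylor estimate for a local defining function and from compactness
  (\<open>compact_C2_hypersurface_quadratically_flat\<close>): near each of its points the hypersurface stays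
  outside two balls of a fixed radius which touch the tangent hyperplane there from its two sides.
  The implicit function theorem is replaced by convexity: near the point the inner ball belongs to
  the body while the tangent hyperplane misses its interior, so there is a boundary point in between, over every small
  tangent vector (\<open>quadratically_flat_imp_supporting_graph\<close>). The heights of these points are
  quadratically small, so that choosing one for each \<open>t v\<close> gives a curve which is differentiable at
  \<open>0\<close>. Hence the tangent space is the whole hyperplane orthogonal to \<open>\<nu>\<close>.
\<close>

section \<open>Uniform quadratic flatness of compact hypersurfaces\<close>

text \<open>This is a curvature bound for \<open>S\<close> at \<open>p\<close> in a form that needs neither charts nor derivatives:
  near \<open>p\<close>, the set lies outside the two balls of radius \<open>1 / (2 k)\<close> that touch the hyperplane
  through \<open>p\<close> orthogonal to \<open>g\<close> in \<open>p\<close>, one from each side.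
  The size of the neighbourhood may depend on \<open>p\<close>; only \<open>k\<close> has to be uniform later.\<close>

definition quadratically_flat :: "'a::euclidean_space set \<Rightarrow> real \<Rightarrow> 'a \<Rightarrow> 'a \<Rightarrow> bool" where
  "quadratically_flat S k p g \<longleftrightarrow>
     norm g = 1 \<and> (\<exists>r>0. \<forall>y\<in>S. dist y p < r \<longrightarrow> \<bar>(y - p) \<bullet> g\<bar> \<le> k * (norm (y - p))\<^sup>2)"

lemma quadratically_flat_mono:
  assumes "quadratically_flat S k p g" "k \<le> k'"
  shows "quadratically_flat S k' p g"
  using assms unfolding quadratically_flat_def
  by (meson mult_right_mono order_trans zero_le_power2)

lemma quadratically_flat_uminus:
  "quadratically_flat S k p (- g) = quadratically_flat S k p g"
  by (simp add: quadratically_flat_def)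

text \<open>The direction \<open>g\<close> at \<open>p\<close> is the normalised gradient of a defining function. Since that function
  vanishes at both \<open>p\<close> and \<open>y\<close>, its linear part at \<open>y - p\<close> equals minus the Taylor remainder, which
  is at most \<open>B \<bar>y - p\<bar>\<^sup>2\<close>. Near \<open>p0\<close> the second derivative is bounded and the gradient is bounded
  away from \<open>0\<close>, so one constant serves all \<open>p\<close> there.\<close>

lemma C2_hypersurface_locally_quadratically_flat:
  fixes S :: "'a::euclidean_space set"
  assumes S: "C2_hypersurface S" and p0: "p0 \<in> S"
  shows "\<exists>r>0. \<exists>k. \<forall>p\<in>S \<inter> ball p0 r. \<exists>g. quadratically_flat S k p g"
proof -
  obtain U f where U: "open U" "p0 \<in> U" and C2: "C2_on f U"
    and nz: "frechet_derivative f (at p0) \<noteq> (\<lambda>_. 0)"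
    and SU: "S \<inter> U = {x \<in> U. f x = 0}"
    using S p0 unfolding C2_hypersurface_def by blast
  obtain f' :: "'a \<Rightarrow> 'a \<Rightarrow>\<^sub>L real" and f'' :: "'a \<Rightarrow> 'a \<Rightarrow>\<^sub>L ('a \<Rightarrow>\<^sub>L real)"
    where f': "\<And>x. x \<in> U \<Longrightarrow> (f has_derivative blinfun_apply (f' x)) (at x)"
      and f'': "\<And>x. x \<in> U \<Longrightarrow> (f' has_derivative blinfun_apply (f'' x)) (at x)"
      and cont: "continuous_on U f''"
    using C2 unfolding C2_on_def by blast
  have "frechet_derivative f (at p0) = blinfun_apply (f' p0)"
    using frechet_derivative_at[OF f'[OF U(2)]] by simp
  then have "f' p0 \<noteq> 0" using nz by auto
  define c where "c = norm (f' p0) / 2"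
  have c: "c > 0" using \<open>f' p0 \<noteq> 0\<close> by (simp add: c_def)
  define B where "B = norm (f'' p0) + 1"
  have B: "B > 0" by (simp add: B_def add_nonneg_pos)
  have "isCont f' p0"
    using f''[OF U(2)] has_derivative_continuous by blast
  then have "((\<lambda>y. norm (f' y)) \<longlongrightarrow> norm (f' p0)) (at p0)"
    by (intro tendsto_intros) (simp add: isCont_def)
  moreover have "c < norm (f' p0)" using c by (simp add: c_def)
  ultimately have "\<forall>\<^sub>F y in at p0. c < norm (f' y)" by (rule order_tendstoD)
  then have e1: "\<forall>\<^sub>F y in nhds p0. c < norm (f' y)"
    using \<open>c < norm (f' p0)\<close> by (simp add: eventually_nhds_conv_at)
  have "isCont f'' p0"
    using cont U continuous_on_eq_continuous_at by blast
  then have "((\<lambda>y. norm (f'' y)) \<longlongrightarrow> norm (f'' p0)) (at p0)"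
    by (intro tendsto_intros) (simp add: isCont_def)
  then have "\<forall>\<^sub>F y in at p0. norm (f'' y) < B"
    by (rule order_tendstoD) (simp add: B_def)
  then have e2: "\<forall>\<^sub>F y in nhds p0. norm (f'' y) < B"
    by (simp add: eventually_nhds_conv_at B_def)
  have e3: "\<forall>\<^sub>F y in nhds p0. y \<in> U" using U eventually_nhds by blast
  from eventually_conj[OF e1 eventually_conj[OF e2 e3]] obtain r where r: "r > 0"
    and near: "\<And>y. dist y p0 < r \<Longrightarrow> c < norm (f' y) \<and> norm (f'' y) < B \<and> y \<in> U"
    unfolding eventually_nhds_metric by blast
  have bU: "ball p0 r \<subseteq> U" using near by (auto simp: dist_commute)
  have lip: "norm (f' x - f' y) \<le> B * norm (x - y)" if "x \<in> ball p0 r" "y \<in> ball p0 r" for x y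
  proof (rule differentiable_bound[OF convex_ball[of p0 r] _ _ that])
    fix z assume z: "z \<in> ball p0 r"
    then show "(f' has_derivative blinfun_apply (f'' z)) (at z within ball p0 r)"
      using bU f'' has_derivative_at_withinI by blast
    show "onorm (blinfun_apply (f'' z)) \<le> B"
      using near[of z] z by (simp add: norm_blinfun.rep_eq[symmetric] dist_commute)
  qed
  have taylor: "norm (f y - f x - f' x (y - x)) \<le> B * (norm (y - x))\<^sup>2"
    if x: "x \<in> ball p0 r" and y: "y \<in> ball p0 r" for x y
  proof -
    have seg: "closed_segment x y \<subseteq> ball p0 r"
      using x y by (simp add: closed_segment_subset)
    have "norm (f y - f x - f' x (y - x)) \<le> norm (y - x) * (B * norm (y - x))"
    proof (rule differentiable_bound_linearization[where S = "closed_segment x y"])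
      show "x + t *\<^sub>R (y - x) \<in> closed_segment x y" if "t \<in> {0..1}" for t
        using that by (auto simp: closed_segment_def algebra_simps intro!: exI[of _ t])
      fix z assume z: "z \<in> closed_segment x y"
      then show "(f has_derivative blinfun_apply (f' z)) (at z within closed_segment x y)"
        using seg bU f' has_derivative_at_withinI by blast
      have "onorm (blinfun_apply (f' z - f' x)) \<le> B * norm (y - x)"
      proof -
        have "norm (f' z - f' x) \<le> B * norm (z - x)" using lip seg z x by blast
        also have "\<dots> \<le> B * norm (y - x)"
          using segment_bound1[OF z] B by simp
        finally show ?thesis by (simp add: norm_blinfun.rep_eq)
      qed
      then show "onorm (blinfun_apply (f' z) - blinfun_apply (f' x)) \<le> B * norm (y - x)"
        by (simp add: minus_blinfun.rep_eq fun_diff_def)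
    qed auto
    then show ?thesis by (simp add: power2_eq_square algebra_simps)
  qed
  have "\<exists>g. quadratically_flat S (B / c) p g" if p: "p \<in> S \<inter> ball p0 r" for p
  proof -
    \<comment> \<open>\<open>G\<close> is the gradient of \<open>f\<close> at \<open>p\<close>.\<close>
    define G where "G = adjoint (blinfun_apply (f' p)) 1"
    have G: "f' p h = h \<bullet> G" for h
      using adjoint_works[of "blinfun_apply (f' p)" h 1]
      by (simp add: G_def blinfun.bounded_linear_right bounded_linear.linear)
    have "norm (f' p) \<le> norm G"
      by (rule norm_blinfun_bound) (simp_all add: G Cauchy_Schwarz_ineq2 mult.commute)
    then have Gc: "c < norm G" using near[of p] p by (simp add: dist_commute)
    have "\<bar>(y - p) \<bullet> (G /\<^sub>R norm G)\<bar> \<le> B / c * (norm (y - p))\<^sup>2"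
      if y: "y \<in> S" "dist y p < r - dist p p0" for y
    proof -
      have "dist y p0 < r" using y(2) dist_triangle[of y p0 p] by linarith
      then have yb: "y \<in> ball p0 r" by (simp add: dist_commute)
      have "f y = 0" "f p = 0" using SU bU yb p y(1) by blast+
      then have t: "\<bar>(y - p) \<bullet> G\<bar> \<le> B * (norm (y - p))\<^sup>2"
        using taylor[of p y] p yb by (simp add: G)
      have "\<bar>(y - p) \<bullet> (G /\<^sub>R norm G)\<bar> = \<bar>(y - p) \<bullet> G\<bar> / norm G"
        by (simp add: abs_mult divide_inverse)
      also have "\<dots> \<le> (B * (norm (y - p))\<^sup>2) / c"
        using t Gc c B by (intro frac_le) auto
      finally show ?thesis by simp
    qed
    moreover have "norm (G /\<^sub>R norm G) = 1" using Gc c by (auto simp: field_simps)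
    moreover have "r - dist p p0 > 0" using p by (simp add: dist_commute)
    ultimately show ?thesis unfolding quadratically_flat_def by blast
  qed
  then show ?thesis using r by blast
qed

lemma compact_C2_hypersurface_quadratically_flat:
  fixes S :: "'a::euclidean_space set"
  assumes "compact S" "C2_hypersurface S"
  shows "\<exists>k>0. \<forall>p\<in>S. \<exists>g. quadratically_flat S k p g"
proof -
  obtain r k where r: "\<And>p. p \<in> S \<Longrightarrow> r p > (0::real)"
    and k: "\<And>p q. p \<in> S \<Longrightarrow> q \<in> S \<inter> ball p (r p) \<Longrightarrow> \<exists>g. quadratically_flat S (k p) q g"
    using C2_hypersurface_locally_quadratically_flat[OF assms(2)] by metis
  have "S \<subseteq> (\<Union>p\<in>S. ball p (r p))" using r by force
  then obtain F where F: "F \<subseteq> S" "finite F" "S \<subseteq> (\<Union>p\<in>F. ball p (r p))"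
    by (rule compactE_image[OF assms(1) open_ball])
  define m where "m = Max (insert 1 (k ` F))"
  have "m > 0" using F(2) by (auto simp: m_def Max_gr_iff)
  moreover have "\<exists>g. quadratically_flat S m q g" if q: "q \<in> S" for q
  proof -
    obtain p where p: "p \<in> F" "q \<in> ball p (r p)" using F(3) q by blast
    then obtain g where "quadratically_flat S (k p) q g" using k F(1) q by blast
    moreover have "k p \<le> m" using F(2) p(1) by (auto simp: m_def)
    ultimately show ?thesis using quadratically_flat_mono by blast
  qed
  ultimately show ?thesis by blast
qed

section \<open>The boundary of a convex body as a graph\<close>

lemma segment_avoiding_frontier_stays_inside:
  fixes K :: "'a::euclidean_space set"
  assumes "a \<in> K" and "closed_segment a b \<inter> frontier K = {}"
  shows "b \<in> interior K"
proof -
  have "closed_segment a b \<subseteq> K"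
    using connected_Int_frontier[of "closed_segment a b" K] assms by auto
  moreover have "b \<notin> frontier K" using assms(2) by auto
  ultimately show ?thesis
    using closure_subset[of K] unfolding frontier_def by auto
qed

text \<open>The point \<open>q\<close> only tells on which side of the hyperplane the body lies: the ray from \<open>p\<close> towards
  \<open>q\<close> is in the interior. At time \<open>t\<close>, the segment between the rays with directions \<open>q - p\<close> and \<open>h\<close>
  has height at least \<open>t c\<close> over the hyperplane but only distance \<open>t R\<close> from \<open>p\<close>. By
  flatness it does not meet the frontier once \<open>t\<close> is small, so its other end is interior too.\<close>

lemma inner_ray_enters_interior:
  fixes K :: "'a::euclidean_space set"
  assumes K: "convex K" and p: "p \<in> closure K" and q: "q \<in> interior K"
    and qg: "0 < (q - p) \<bullet> g" and flat: "quadratically_flat (frontier K) k p g" and k: "k > 0"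
    and h: "0 < h \<bullet> g"
  shows "\<exists>\<epsilon>>0. \<forall>t. 0 < t \<and> t < \<epsilon> \<longrightarrow> p + t *\<^sub>R h \<in> interior K"
proof -
  obtain r where r: "r > 0"
    and bd: "\<And>y. y \<in> frontier K \<Longrightarrow> dist y p < r \<Longrightarrow> \<bar>(y - p) \<bullet> g\<bar> \<le> k * (norm (y - p))\<^sup>2"
    using flat unfolding quadratically_flat_def by blast
  define c where "c = min ((q - p) \<bullet> g) (h \<bullet> g)"
  define R where "R = norm (q - p) + norm h + 1"
  define \<epsilon> where "\<epsilon> = min 1 (min (r / R) (c / (k * R\<^sup>2)))"
  have c: "c > 0" using qg h by (simp add: c_def)
  have R: "R > 0" by (simp add: R_def add_nonneg_pos)
  have "p + t *\<^sub>R h \<in> interior K" if t: "0 < t" "t < \<epsilon>" for t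
  proof (rule segment_avoiding_frontier_stays_inside)
    have t1: "t < 1" and "t < r / R" and "t < c / (k * R\<^sup>2)" using t by (auto simp: \<epsilon>_def)
    then have tR: "t * R < r" and tc: "t * (k * R\<^sup>2) < c"
      using R k by (simp_all add: pos_less_divide_eq)
    have "p - t *\<^sub>R (p - q) \<in> interior K"
      using mem_interior_closure_convex_shrink[OF K q p, of t] t t1 by simp
    then show "p + t *\<^sub>R (q - p) \<in> K"
      using interior_subset by (auto simp: algebra_simps)
    show "closed_segment (p + t *\<^sub>R (q - p)) (p + t *\<^sub>R h) \<inter> frontier K = {}"
    proof (rule ccontr)
      assume "\<not> ?thesis"
      then obtain z where z: "z \<in> closed_segment (p + t *\<^sub>R (q - p)) (p + t *\<^sub>R h)"
        and zf: "z \<in> frontier K" by blast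
      then obtain s where s: "0 \<le> s" "s \<le> 1"
        and "z = (1 - s) *\<^sub>R (p + t *\<^sub>R (q - p)) + s *\<^sub>R (p + t *\<^sub>R h)"
        by (auto simp: closed_segment_def)
      then have zp: "z - p = t *\<^sub>R ((1 - s) *\<^sub>R (q - p) + s *\<^sub>R h)"
        by (simp add: algebra_simps)
      have "norm ((1 - s) *\<^sub>R (q - p) + s *\<^sub>R h) \<le> (1 - s) * norm (q - p) + s * norm h"
        using s by (intro norm_triangle_le) simp
      also have "\<dots> \<le> 1 * norm (q - p) + 1 * norm h"
        using s by (intro add_mono mult_right_mono) auto
      also have "\<dots> \<le> R" by (simp add: R_def)
      finally have nz: "norm (z - p) \<le> t * R"
        using t unfolding zp by simp
      have "c = (1 - s) * c + s * c" by (simp add: algebra_simps)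
      also have "\<dots> \<le> (1 - s) * ((q - p) \<bullet> g) + s * (h \<bullet> g)"
        using s by (intro add_mono mult_left_mono) (auto simp: c_def)
      also have "\<dots> = ((1 - s) *\<^sub>R (q - p) + s *\<^sub>R h) \<bullet> g" by (simp only: inner_left_distrib inner_scaleR_left)
      finally have "t * c \<le> (z - p) \<bullet> g"
        using t unfolding zp by simp
      also have "\<dots> \<le> k * (norm (z - p))\<^sup>2"
        using bd[OF zf] nz tR by (simp add: dist_norm)
      also have "\<dots> \<le> k * (t * R)\<^sup>2"
        using nz k by (intro mult_left_mono power_mono) auto
      also have "\<dots> = t * (t * (k * R\<^sup>2))" by (simp add: power2_eq_square algebra_simps)
      also have "\<dots> < t * c" using tc t by simp
      finally show False by simp
    qed
  qed
  moreover have "\<epsilon> > 0" using r c R k by (simp add: \<epsilon>_def)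
  ultimately show ?thesis by blast
qed

text \<open>Here \<open>\<nu>\<close> is an inner normal of \<open>K\<close> at \<open>p\<close>. The last clause puts a frontier point between
  the tangent hyperplane and the paraboloid of height \<open>k \<bar>w\<bar>\<^sup>2\<close>, over every small tangent vector; how
  the height \<open>a\<close> depends on \<open>w\<close> is left open, since the bound alone gives differentiability at \<open>p\<close>.\<close>

definition supporting_graph :: "'a::euclidean_space set \<Rightarrow> real \<Rightarrow> 'a \<Rightarrow> 'a \<Rightarrow> bool" where
  "supporting_graph K k p \<nu> \<longleftrightarrow>
     norm \<nu> = 1 \<and> (\<forall>y\<in>K. 0 \<le> (y - p) \<bullet> \<nu>) \<and>
     (\<exists>\<delta>>0. \<forall>w. w \<bullet> \<nu> = 0 \<and> norm w < \<delta> \<longrightarrow>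
        (\<exists>a. 0 \<le> a \<and> a \<le> k * (norm w)\<^sup>2 \<and> p + w + a *\<^sub>R \<nu> \<in> frontier K))"

text \<open>The hyperplane orthogonal to \<open>g\<close> supports \<open>K\<close>: if \<open>y \<in> K\<close> were strictly below it, the ray from \<open>p\<close> away from
  \<open>y\<close> would enter the interior, and \<open>p\<close>, being between \<open>y\<close> and an interior point, would be interior
  itself. For a small tangent vector \<open>w\<close>, the point \<open>p + w + b \<nu>\<close> with \<open>b = 2 k \<bar>w\<bar>\<^sup>2\<close> is in \<open>K\<close>,
  as it is joined to the interior point \<open>p + b \<nu>\<close> by a segment in the inner one of the two balls
  that flatness keeps free of the frontier.
  As \<open>p + w\<close> is not interior, the frontier is met on the way down. The factor \<open>2\<close> leaves room for the term
  \<open>b\<^sup>2\<close> in the squared distance from \<open>p\<close>.\<close>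

lemma quadratically_flat_imp_supporting_graph:
  fixes K :: "'a::euclidean_space set"
  assumes K: "convex K" "closed K" "interior K \<noteq> {}" and p: "p \<in> frontier K"
    and flat: "quadratically_flat (frontier K) k p g" and k: "k > 0"
  shows "\<exists>\<nu>. supporting_graph K (2 * k) p \<nu>"
proof -
  have ng: "norm g = 1" using flat by (simp add: quadratically_flat_def)
  obtain q0 where q0: "q0 \<in> interior K" using K(3) by blast
  \<comment> \<open>An interior point off the hyperplane is needed to decide between \<open>g\<close> and \<open>- g\<close>; if \<open>q0\<close> happens
    to lie on it, a small shift along \<open>g\<close> remedies that.\<close>
  obtain q where q: "q \<in> interior K" and qg: "(q - p) \<bullet> g \<noteq> 0"
  proof (cases "(q0 - p) \<bullet> g = 0")
    case True
    obtain e where e: "e > 0" "ball q0 e \<subseteq> interior K"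
      using q0 open_contains_ball[of "interior K"] by auto
    have "q0 + (e / 2) *\<^sub>R g \<in> interior K"
      using e ng by (intro subsetD[OF e(2)]) (simp add: dist_norm)
    moreover have "(q0 + (e / 2) *\<^sub>R g - p) \<bullet> g = (q0 - p) \<bullet> g + e / 2"
      using ng by (simp add: algebra_simps dot_square_norm)
    ultimately show ?thesis using that True e(1) by simp
  qed (use q0 that in blast)
  define \<nu> where "\<nu> = (if (q - p) \<bullet> g > 0 then g else - g)"
  have n1: "norm \<nu> = 1" using ng by (simp add: \<nu>_def)
  then have nn: "\<nu> \<bullet> \<nu> = 1" by (simp add: dot_square_norm)
  have qn: "(q - p) \<bullet> \<nu> > 0" using qg by (simp add: \<nu>_def)
  have flat': "quadratically_flat (frontier K) k p \<nu>"
    using flat by (simp add: \<nu>_def quadratically_flat_uminus)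
  have pK: "p \<in> closure K" and pI: "p \<notin> interior K" using p by (auto simp: frontier_def)
  note enter = inner_ray_enters_interior[OF K(1) pK q qn flat' k]
  have half: "0 \<le> (y - p) \<bullet> \<nu>" if y: "y \<in> K" for y
  proof (rule ccontr)
    assume "\<not> ?thesis"
    then have "0 < (p - y) \<bullet> \<nu>" by (simp add: inner_diff_left)
    from enter[OF this] obtain \<epsilon> where "\<epsilon> > 0"
      and "\<forall>t. 0 < t \<and> t < \<epsilon> \<longrightarrow> p + t *\<^sub>R (p - y) \<in> interior K" by blast
    then have c: "p + (\<epsilon> / 2) *\<^sub>R (p - y) \<in> interior K" and e: "\<epsilon> / 2 > 0" by auto
    define e where "e = \<epsilon> / 2"
    have "y - (1 / (1 + e)) *\<^sub>R (y - (p + e *\<^sub>R (p - y))) \<in> interior K"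
      using mem_interior_convex_shrink[OF K(1) c y, of "1 / (1 + e)"] e by (simp add: e_def)
    moreover have "y - (p + e *\<^sub>R (p - y)) = (1 + e) *\<^sub>R (y - p)" by (simp add: algebra_simps)
    ultimately show False using pI e by (simp add: e_def)
  qed
  have tangent: "p + w \<notin> interior K" if w: "w \<bullet> \<nu> = 0" for w
  proof
    assume "p + w \<in> interior K"
    then obtain e where e: "e > 0" "ball (p + w) e \<subseteq> K"
      using mem_interior by blast
    have "p + w - (e / 2) *\<^sub>R \<nu> \<in> K"
      using e n1 by (intro subsetD[OF e(2)]) (simp add: dist_norm)
    from half[OF this] show False using w e(1) nn by (simp add: inner_diff_left inner_add_left)
  qed
  obtain r where r: "r > 0"
    and bd: "\<And>y. y \<in> frontier K \<Longrightarrow> dist y p < r \<Longrightarrow> \<bar>(y - p) \<bullet> \<nu>\<bar> \<le> k * (norm (y - p))\<^sup>2"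
    using flat' unfolding quadratically_flat_def by blast
  obtain \<epsilon> where \<epsilon>: "\<epsilon> > 0" "\<And>t. 0 < t \<Longrightarrow> t < \<epsilon> \<Longrightarrow> p + t *\<^sub>R \<nu> \<in> interior K"
    using enter[of \<nu>] nn by auto
  \<comment> \<open>For \<open>b = 2 k \<bar>w\<bar>\<^sup>2\<close> and \<open>\<bar>w\<bar> \<le> 1\<close>, the three other bounds give \<open>b < \<epsilon>\<close>, \<open>k b < 1/2\<close> and
    \<open>\<bar>w\<bar> + b < r\<close>.\<close>
  define \<delta> where "\<delta> = min 1 (min (\<epsilon> / (2 * k)) (min (1 / (4 * k\<^sup>2)) (r / (1 + 2 * k))))"
  have "\<exists>a. 0 \<le> a \<and> a \<le> 2 * k * (norm w)\<^sup>2 \<and> p + w + a *\<^sub>R \<nu> \<in> frontier K"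
    if w: "w \<bullet> \<nu> = 0" and wd: "norm w < \<delta>" for w
  proof (cases "w = 0")
    case True
    then show ?thesis using p by (intro exI[of _ 0]) simp
  next
    case False
    define b where "b = 2 * k * (norm w)\<^sup>2"
    have b0: "b > 0" using False k by (simp add: b_def)
    have w1: "norm w < 1" and "norm w < \<epsilon> / (2 * k)" and "norm w < 1 / (4 * k\<^sup>2)"
      and "norm w < r / (1 + 2 * k)" using wd by (auto simp: \<delta>_def)
    then have w2: "2 * k * norm w < \<epsilon>" and w3: "k * (2 * k * norm w) < 1 / 2"
      and w4: "norm w + 2 * k * norm w < r"
      using k by (simp_all add: pos_less_divide_eq algebra_simps power2_eq_square)
    have "(norm w)\<^sup>2 \<le> norm w" using w1 by (simp add: power2_eq_square mult_left_le)
    then have bw: "b \<le> 2 * k * norm w" using k by (simp add: b_def)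
    have be: "b < \<epsilon>" and br: "norm w + b < r" using bw w2 w4 by linarith+
    have kb: "k * b < 1 / 2"
      using mult_left_mono[OF bw, of k] w3 k by linarith
    have "p + b *\<^sub>R \<nu> + w \<in> interior K"
    proof (rule segment_avoiding_frontier_stays_inside)
      show "p + b *\<^sub>R \<nu> \<in> K" using \<epsilon>(2)[OF b0 be] interior_subset by blast
      show "closed_segment (p + b *\<^sub>R \<nu>) (p + b *\<^sub>R \<nu> + w) \<inter> frontier K = {}"
      proof (rule ccontr)
        assume "\<not> ?thesis"
        then obtain z where "z \<in> closed_segment (p + b *\<^sub>R \<nu>) (p + b *\<^sub>R \<nu> + w)"
          and zf: "z \<in> frontier K" by blast
        then obtain s where s: "0 \<le> s" "s \<le> 1"
          and "z = (1 - s) *\<^sub>R (p + b *\<^sub>R \<nu>) + s *\<^sub>R (p + b *\<^sub>R \<nu> + w)"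
          by (auto simp: closed_segment_def)
        then have zp: "z - p = s *\<^sub>R w + b *\<^sub>R \<nu>" by (simp add: algebra_simps)
        have sw: "s * norm w \<le> norm w" using s by (simp add: mult_left_le_one_le)
        have "norm (z - p) \<le> s * norm w + b"
          unfolding zp using s b0 n1 by (intro norm_triangle_le) simp
        then have "dist z p < r" using sw br by (simp add: dist_norm)
        from bd[OF zf this] have "b \<le> k * (norm (z - p))\<^sup>2"
          unfolding zp using w nn by (simp add: inner_add_left)
        moreover have "(norm (z - p))\<^sup>2 = (s * norm w)\<^sup>2 + b\<^sup>2"
          unfolding zp using w s b0 n1
          by (subst norm_add_Pythagorean) (simp_all add: orthogonal_def)
        moreover have "(s * norm w)\<^sup>2 \<le> (norm w)\<^sup>2" using sw s by (intro power_mono) auto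
        ultimately have "b \<le> k * ((norm w)\<^sup>2 + b\<^sup>2)"
          using k by (smt (verit) mult_left_mono)
        also have "\<dots> = b / 2 + (k * b) * b" by (simp add: b_def algebra_simps power2_eq_square)
        also have "\<dots> < b / 2 + 1 / 2 * b" using kb b0 by (intro add_strict_left_mono mult_strict_right_mono)
        finally show False by simp
      qed
    qed
    then have top: "p + w + b *\<^sub>R \<nu> \<in> K" using interior_subset by (auto simp: algebra_simps)
    have "closed_segment (p + w + b *\<^sub>R \<nu>) (p + w) \<inter> frontier K \<noteq> {}"
      using segment_avoiding_frontier_stays_inside[OF top, of "p + w"] tangent[OF w] by blast
    then obtain z where z: "z \<in> closed_segment (p + w) (p + w + b *\<^sub>R \<nu>)" and zf: "z \<in> frontier K"
      by (auto simp: closed_segment_commute)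
    then obtain s where s: "0 \<le> s" "s \<le> 1"
      and "z = (1 - s) *\<^sub>R (p + w) + s *\<^sub>R (p + w + b *\<^sub>R \<nu>)"
      by (auto simp: closed_segment_def)
    then have "z = p + w + (s * b) *\<^sub>R \<nu>" by (simp add: algebra_simps)
    then show ?thesis
      using zf s b0 by (intro exI[of _ "s * b"]) (auto simp: b_def[symmetric] mult_left_le_one_le)
  qed
  moreover have "\<delta> > 0" using \<epsilon> r k by (simp add: \<delta>_def)
  ultimately show ?thesis using n1 half unfolding supporting_graph_def by blast
qed

text \<open>The height of a curve in \<open>K\<close> over the supporting hyperplane has a minimum at \<open>p\<close>, so velocities
  are orthogonal to \<open>\<nu>\<close>. Conversely, frontier points chosen arbitrarily over \<open>t v\<close> with heights
  \<open>A t \<le> k \<bar>t v\<bar>\<^sup>2\<close> make a curve with velocity \<open>v\<close> at \<open>0\<close>, no matter how irregular it is elsewhere.\<close>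

lemma tangent_space_frontier_eq_normal_complement:
  fixes K :: "'a::euclidean_space set"
  assumes K: "closed K" and p: "p \<in> frontier K" and gr: "supporting_graph K k p \<nu>"
  shows "tangent_space (frontier K) p = {v. v \<bullet> \<nu> = 0}"
proof (intro equalityI subsetI)
  fix v assume "v \<in> tangent_space (frontier K) p"
  then obtain \<gamma> where g0: "\<gamma> 0 = p" and ev: "\<forall>\<^sub>F t in nhds 0. \<gamma> t \<in> frontier K"
    and der: "(\<gamma> has_vector_derivative v) (at (0::real))"
    by (auto simp: tangent_space_def curve_in_def)
  obtain d where d: "d > 0" "\<And>t. dist t 0 < d \<Longrightarrow> \<gamma> t \<in> frontier K"
    using ev unfolding eventually_nhds_metric by blast
  have "((\<lambda>t. (\<gamma> t - p) \<bullet> \<nu>) has_vector_derivative v \<bullet> \<nu>) (at 0)"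
    using der by (auto intro!: derivative_eq_intros simp: has_vector_derivative_def)
  then have "((\<lambda>t. (\<gamma> t - p) \<bullet> \<nu>) has_real_derivative v \<bullet> \<nu>) (at 0)"
    by (simp add: has_real_derivative_iff_has_vector_derivative)
  then have "v \<bullet> \<nu> = 0"
  proof (rule DERIV_local_min[OF _ d(1)], intro allI impI)
    fix t :: real assume "\<bar>0 - t\<bar> < d"
    then have "\<gamma> t \<in> K" using d(2)[of t] frontier_subset_closed[OF K] by auto
    then show "(\<gamma> 0 - p) \<bullet> \<nu> \<le> (\<gamma> t - p) \<bullet> \<nu>"
      using gr g0 by (simp add: supporting_graph_def)
  qed
  then show "v \<in> {v. v \<bullet> \<nu> = 0}" by simp
next
  fix v assume "v \<in> {v. v \<bullet> \<nu> = 0}"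
  then have v: "v \<bullet> \<nu> = 0" by simp
  obtain \<delta> where \<delta>: "\<delta> > 0"
    and graph: "\<And>w. w \<bullet> \<nu> = 0 \<Longrightarrow> norm w < \<delta> \<Longrightarrow>
      \<exists>a. 0 \<le> a \<and> a \<le> k * (norm w)\<^sup>2 \<and> p + w + a *\<^sub>R \<nu> \<in> frontier K"
    using gr unfolding supporting_graph_def by blast
  have "\<forall>t. norm (t *\<^sub>R v) < \<delta> \<longrightarrow>
      (\<exists>a. 0 \<le> a \<and> a \<le> k * (norm (t *\<^sub>R v))\<^sup>2 \<and> p + t *\<^sub>R v + a *\<^sub>R \<nu> \<in> frontier K)"
    using graph v by (metis inner_scaleR_left mult_zero_right)
  then obtain A where A: "\<And>t. norm (t *\<^sub>R v) < \<delta> \<Longrightarrow>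
      0 \<le> A t \<and> A t \<le> k * (norm (t *\<^sub>R v))\<^sup>2 \<and> p + t *\<^sub>R v + A t *\<^sub>R \<nu> \<in> frontier K"
    by metis
  define \<gamma> where "\<gamma> t = p + t *\<^sub>R v + A t *\<^sub>R \<nu>" for t
  have A0: "A 0 = 0" using A[of 0] \<delta> by simp
  have "((\<lambda>t. norm (t *\<^sub>R v)) \<longlongrightarrow> norm (0 *\<^sub>R v)) (nhds 0)"
    by (intro tendsto_intros filterlim_ident)
  then have small: "\<forall>\<^sub>F t in nhds 0. norm (t *\<^sub>R v) < \<delta>"
    by (rule order_tendstoD) (use \<delta> in simp)
  have "((\<lambda>h. (A (0 + h) - A 0) / h) \<longlongrightarrow> 0) (at 0)"
  proof (rule Lim_null_comparison)
    have "\<forall>\<^sub>F h in at 0. norm (h *\<^sub>R v) < \<delta>"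
      using small unfolding eventually_nhds_conv_at by (rule conjunct1)
    moreover have "\<forall>\<^sub>F h in at (0::real). h \<noteq> 0" by (simp add: eventually_at_filter)
    ultimately show "\<forall>\<^sub>F h in at 0. norm ((A (0 + h) - A 0) / h) \<le> k * (norm v)\<^sup>2 * \<bar>h\<bar>"
    proof eventually_elim
      case (elim h)
      then have "\<bar>A h\<bar> \<le> k * (norm v)\<^sup>2 * \<bar>h\<bar> * \<bar>h\<bar>"
        using A[OF elim(1)] by (simp add: power_mult_distrib power2_eq_square mult.commute mult.left_commute)
      then show ?case using elim(2) A0 by (simp add: pos_divide_le_eq)
    qed
    have "((\<lambda>h. k * (norm v)\<^sup>2 * \<bar>h\<bar>) \<longlongrightarrow> k * (norm v)\<^sup>2 * \<bar>0\<bar>) (at (0::real))"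
      by (intro tendsto_intros)
    then show "((\<lambda>h. k * (norm v)\<^sup>2 * \<bar>h\<bar>) \<longlongrightarrow> 0) (at (0::real))" by simp
  qed
  then have "(A has_real_derivative 0) (at 0)" by (simp add: DERIV_def)
  then have "(\<gamma> has_vector_derivative v) (at 0)"
    unfolding \<gamma>_def
    by (auto intro!: derivative_eq_intros simp: has_vector_derivative_def has_field_derivative_def)
  moreover have "\<forall>\<^sub>F t in nhds 0. \<gamma> t \<in> frontier K"
    using small by eventually_elim (use A in \<open>simp add: \<gamma>_def\<close>)
  ultimately have "curve_in (frontier K) p v \<gamma>"
    using A0 by (simp add: curve_in_def \<gamma>_def)
  then show "v \<in> tangent_space (frontier K) p" by (auto simp: tangent_space_def)
qed

section \<open>Reflection law and maximality at a single vertex\<close>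

lemma has_real_derivative_dist_along_curve:
  fixes x :: "'a::euclidean_space"
  assumes "(\<gamma> has_vector_derivative v) (at t)" "x \<noteq> \<gamma> t"
  shows "((\<lambda>s. dist x (\<gamma> s)) has_real_derivative - (sgn (x - \<gamma> t) \<bullet> v)) (at t)"
proof -
  have "((\<lambda>s. x - \<gamma> s) has_derivative (\<lambda>h. - (h *\<^sub>R v))) (at t)"
    using assms(1) by (auto intro!: derivative_eq_intros simp: has_vector_derivative_def)
  from has_derivative_compose[OF this has_derivative_norm] assms(2)
  have "((\<lambda>s. norm (x - \<gamma> s)) has_derivative (\<lambda>h. - (h *\<^sub>R v) \<bullet> sgn (x - \<gamma> t))) (at t)" by simp
  moreover have "(\<lambda>h. - (h *\<^sub>R v) \<bullet> sgn (x - \<gamma> t)) = (*) (- (sgn (x - \<gamma> t) \<bullet> v))"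
    by (auto simp: inner_commute)
  ultimately show ?thesis
    by (simp add: has_field_derivative_def dist_norm)
qed

text \<open>The incoming and the outgoing direction have opposite tangential components. This is the
  criticality of the length of the path in its middle vertex.\<close>

lemma reflection_law:
  fixes x :: "int \<Rightarrow> 'a::euclidean_space"
  assumes crit: "critical_on S n n (Phi x n n) x"
    and ne: "x (n - 1) \<noteq> x n" "x (n + 1) \<noteq> x n"
    and v: "v \<in> tangent_space S (x n)"
  shows "(sgn (x (n - 1) - x n) + sgn (x (n + 1) - x n)) \<bullet> v = 0"
proof -
  obtain \<gamma> where \<gamma>: "curve_in S (x n) v \<gamma>" using v by (auto simp: tangent_space_def)
  then have "((\<lambda>t. Phi x n n (\<lambda>i. \<gamma> t)) has_real_derivative 0) (at 0)"
    using crit[unfolded critical_on_def, rule_format, of "\<lambda>_. v" "\<lambda>_. \<gamma>"] by simp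
  then have "((\<lambda>t. dist (x (n - 1)) (\<gamma> t) + dist (x (n + 1)) (\<gamma> t)) has_real_derivative 0) (at 0)"
    by (simp add: Phi_def dist_commute)
  moreover have "\<gamma> 0 = x n" "(\<gamma> has_vector_derivative v) (at 0)"
    using \<gamma> by (simp_all add: curve_in_def)
  then have "((\<lambda>t. dist (x (n - 1)) (\<gamma> t) + dist (x (n + 1)) (\<gamma> t)) has_real_derivative
      - (sgn (x (n - 1) - x n) \<bullet> v) + - (sgn (x (n + 1) - x n) \<bullet> v)) (at 0)"
    using has_real_derivative_dist_along_curve[of \<gamma> v 0] ne by (intro DERIV_add) force+
  ultimately show ?thesis
    using DERIV_unique by (fastforce simp: inner_add_left)
qed

text \<open>In this form the two end legs are no longer special, so that all legs at a vertex can be split off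
  in the same way.\<close>

lemma Phi_eq_polygon_length:
  assumes "A \<le> B" "u (A - 1) = x (A - 1)" "u (B + 1) = x (B + 1)"
  shows "Phi x A B u = (\<Sum>i\<in>{A-1..B}. dist (u i) (u (i + 1)))"
proof -
  have "{A-1..B} = insert (A - 1) (insert B {A..B-1})" using assms(1) by auto
  then show ?thesis using assms by (simp add: Phi_def)
qed

lemma local_max_single_vertex:
  fixes x :: "int \<Rightarrow> 'a::euclidean_space"
  assumes max: "local_max_on S A B (Phi x A B) x" and n: "A \<le> n" "n \<le> B"
    and S: "\<And>i. i \<in> {A..B} \<Longrightarrow> x i \<in> S"
  shows "\<exists>\<epsilon>>0. \<forall>u\<in>S. dist u (x n) < \<epsilon> \<longrightarrow>
    dist (x (n - 1)) u + dist u (x (n + 1)) \<le> dist (x (n - 1)) (x n) + dist (x n) (x (n + 1))"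
proof -
  obtain \<epsilon> where \<epsilon>: "\<epsilon> > 0"
    and mx: "\<And>u. (\<forall>i\<in>{A..B}. u i \<in> S \<and> dist (u i) (x i) < \<epsilon>) \<Longrightarrow> Phi x A B u \<le> Phi x A B x"
    using max unfolding local_max_on_def by blast
  have split: "Phi x A B y = (dist (y (n - 1)) (y n) + dist (y n) (y (n + 1))) +
      (\<Sum>i\<in>{A-1..B} - {n - 1, n}. dist (y i) (y (i + 1)))"
    if "y (A - 1) = x (A - 1)" "y (B + 1) = x (B + 1)" for y
  proof -
    have "{n - 1, n} \<subseteq> {A-1..B}" using n by auto
    then have "(\<Sum>i\<in>{A-1..B}. dist (y i) (y (i + 1))) = (\<Sum>i\<in>{A-1..B} - {n - 1, n}. dist (y i) (y (i + 1))) +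
       (\<Sum>i\<in>{n - 1, n}. dist (y i) (y (i + 1)))"
      by (intro sum.subset_diff) auto
    then show ?thesis using Phi_eq_polygon_length[of A B y x] n that by simp
  qed
  have "dist (x (n - 1)) u + dist u (x (n + 1)) \<le> dist (x (n - 1)) (x n) + dist (x n) (x (n + 1))"
    if u: "u \<in> S" "dist u (x n) < \<epsilon>" for u
  proof -
    define y where "y = x(n := u)"
    have "Phi x A B y \<le> Phi x A B x"
      using u S \<epsilon> by (intro mx) (auto simp: y_def)
    moreover have "(\<Sum>i\<in>{A-1..B} - {n - 1, n}. dist (y i) (y (i + 1))) =
        (\<Sum>i\<in>{A-1..B} - {n - 1, n}. dist (x i) (x (i + 1)))"
      by (intro sum.cong) (auto simp: y_def)
    ultimately have "dist (y (n - 1)) (y n) + dist (y n) (y (n + 1)) \<le>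
        dist (x (n - 1)) (x n) + dist (x n) (x (n + 1))"
      using split[of x] split[of y] n by (simp add: y_def)
    then show ?thesis by (simp add: y_def)
  qed
  then show ?thesis using \<epsilon> by blast
qed

text \<open>In the infinite case the three-point segment around the vertex is maximizing by definition; in the
  finite case only the whole configuration is, and the other vertices are held fixed.\<close>

lemma maximizing_configuration_vertex_maximal:
  fixes x :: "int \<Rightarrow> 'a::euclidean_space"
  assumes m: "maximizing_configuration S I x" and n: "n - 1 \<in> I" "n \<in> I" "n + 1 \<in> I"
  shows "\<exists>\<epsilon>>0. \<forall>u\<in>S. dist u (x n) < \<epsilon> \<longrightarrow>
    dist (x (n - 1)) u + dist u (x (n + 1)) \<le> dist (x (n - 1)) (x n) + dist (x n) (x (n + 1))"
proof -
  have int: "\<And>a b. a \<in> I \<Longrightarrow> b \<in> I \<Longrightarrow> {a..b} \<subseteq> I" and S: "\<And>i. i \<in> I \<Longrightarrow> x i \<in> S"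
    using m by (auto simp: maximizing_configuration_def billiard_configuration_def)
  obtain M N where MN: "M \<le> n - 1" "n + 1 \<le> N" "{M..N} \<subseteq> I" "maximizing_segment S M N x"
  proof (cases "finite I")
    case True
    then obtain M N where "I = {M..N}" "maximizing_segment S M N x"
      using m by (auto simp: maximizing_configuration_def)
    then show ?thesis using n that by auto
  next
    case False
    then have "maximizing_segment S (n - 1) (n + 1) x"
      using m int[OF n(1,3)] by (auto simp: maximizing_configuration_def)
    then show ?thesis using that int[OF n(1,3)] by blast
  qed
  show ?thesis
  proof (rule local_max_single_vertex)
    show "local_max_on S (M + 1) (N - 1) (Phi x (M + 1) (N - 1)) x"
      using MN(4) by (simp add: maximizing_segment_def)
    show "x i \<in> S" if "i \<in> {M + 1..N - 1}" for i
      using subsetD[OF MN(3), of i] S that by simp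
  qed (use MN(1,2) in auto)
qed

section \<open>Steepness of locally longest paths\<close>

text \<open>The gain \<open>\<bar>w\<bar>\<^sup>2\<close> in squared distance beats the loss \<open>2 a ((x - p) \<bullet> \<nu>)\<close>.\<close>

lemma dist_increases_when_sliding_sideways:
  fixes x :: "'a::euclidean_space"
  assumes "norm \<nu> = 1" "w \<bullet> \<nu> = 0" "w \<bullet> (x - p) = 0" "w \<noteq> 0"
    and a: "0 \<le> a" "a \<le> k * (norm w)\<^sup>2"
    and h: "0 \<le> (x - p) \<bullet> \<nu>" "2 * k * ((x - p) \<bullet> \<nu>) < 1"
  shows "dist x p < dist x (p + w + a *\<^sub>R \<nu>)"
proof -
  define e where "e = x - p"
  have "\<nu> \<bullet> \<nu> = 1" "w \<bullet> e = 0" using assms(1,3) by (simp_all add: dot_square_norm e_def)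
  then have "(norm (e - (w + a *\<^sub>R \<nu>)))\<^sup>2 = (norm e)\<^sup>2 + (norm w)\<^sup>2 + a\<^sup>2 - 2 * a * (e \<bullet> \<nu>)"
    using assms(2) unfolding power2_norm_eq_inner
    by (simp add: inner_add_left inner_add_right inner_diff_left inner_diff_right
        inner_commute[of e w] inner_commute[of \<nu> w] inner_commute[of \<nu> e] power2_eq_square algebra_simps)
  moreover have "x - (p + w + a *\<^sub>R \<nu>) = e - (w + a *\<^sub>R \<nu>)" by (simp add: e_def)
  ultimately have "(dist x (p + w + a *\<^sub>R \<nu>))\<^sup>2 =
      (dist x p)\<^sup>2 + (norm w)\<^sup>2 + a\<^sup>2 - 2 * a * ((x - p) \<bullet> \<nu>)"
    by (simp only: dist_norm e_def)
  moreover have "2 * a * ((x - p) \<bullet> \<nu>) \<le> 2 * (k * (norm w)\<^sup>2) * ((x - p) \<bullet> \<nu>)"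
    using a h by (intro mult_right_mono) auto
  moreover have "(norm w)\<^sup>2 * (2 * k * ((x - p) \<bullet> \<nu>)) < (norm w)\<^sup>2 * 1"
    using assms(4) h by (intro mult_strict_left_mono) auto
  ultimately have "(dist x p)\<^sup>2 < (dist x (p + w + a *\<^sub>R \<nu>))\<^sup>2"
    by (simp add: algebra_simps) (smt (verit) zero_le_power2)
  then show ?thesis by (simp add: power2_less_imp_less)
qed

lemma exists_nonzero_orthogonal_to_two:
  fixes a b :: "'a::euclidean_space"
  assumes "DIM('a) > 2"
  shows "\<exists>v. v \<noteq> 0 \<and> v \<bullet> a = 0 \<and> v \<bullet> b = 0"
proof -
  have "dim {a, b} \<le> card {a, b}" by (rule dim_le_card') simp
  also have "\<dots> \<le> 2" by (simp add: card_insert_if)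
  finally obtain v where "v \<noteq> 0" "span {a, b} \<subseteq> {x. v \<bullet> x = 0}"
    using lowdim_subset_hyperplane[of "{a, b}"] assms by auto
  then show ?thesis using span_superset[of "{a, b}"] by auto
qed

text \<open>The sum \<open>e + e'\<close> is a multiple \<open>c \<nu>\<close>, and \<open>\<bar>c \<nu> - e\<bar> = 1\<close> forces \<open>c = 0\<close> or \<open>c = 2 (e \<bullet> \<nu>)\<close>. In
  the first case \<open>e' = - e\<close>, and both heights vanish by the sign conditions.\<close>

lemma reflected_unit_vector_same_height:
  fixes e e' \<nu> :: "'a::euclidean_space"
  assumes n: "norm e = 1" "norm e' = 1" "norm \<nu> = 1"
    and pos: "0 \<le> e \<bullet> \<nu>" "0 \<le> e' \<bullet> \<nu>"
    and law: "\<And>v. v \<bullet> \<nu> = 0 \<Longrightarrow> (e + e') \<bullet> v = 0"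
  shows "e \<bullet> \<nu> = e' \<bullet> \<nu>"
proof -
  define c where "c = (e + e') \<bullet> \<nu>"
  define d where "d = e + e' - c *\<^sub>R \<nu>"
  have nn: "\<nu> \<bullet> \<nu> = 1" "e \<bullet> e = 1" "e' \<bullet> e' = 1" using n by (simp_all add: dot_square_norm)
  have d\<nu>: "d \<bullet> \<nu> = 0" using nn by (simp add: d_def c_def inner_diff_left)
  have "d \<bullet> d = (e + e') \<bullet> d - c * (\<nu> \<bullet> d)" by (simp add: d_def inner_diff_left)
  then have "d = 0" using law[OF d\<nu>] d\<nu> by (simp add: inner_commute)
  then have e': "e' = c *\<^sub>R \<nu> - e" by (simp add: d_def algebra_simps)
  have "e' \<bullet> e' = c * c * (\<nu> \<bullet> \<nu>) - 2 * c * (e \<bullet> \<nu>) + e \<bullet> e"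
    unfolding e'
    by (simp add: inner_diff_left inner_diff_right inner_commute[of \<nu> e] algebra_simps)
  then have "c * c = 2 * c * (e \<bullet> \<nu>)" by (simp only: nn mult_1_right)
  then have "c = 0 \<or> c = 2 * (e \<bullet> \<nu>)" by (cases "c = 0") simp_all
  moreover have "c = e \<bullet> \<nu> + e' \<bullet> \<nu>" by (simp add: c_def inner_add_left)
  ultimately show ?thesis using pos by linarith
qed

text \<open>If the common height \<open>s\<close> of the two unit directions is below \<open>1 / (2 k D)\<close>, both legs grow when
  \<open>p\<close> moves sideways, in a tangent direction \<open>v\<close> orthogonal to \<open>x - p\<close>. There is room for such a
  \<open>v\<close> because the dimension exceeds two, and by the reflection law it is orthogonal to \<open>z - p\<close> as well.\<close>

lemma locally_longest_path_is_steep: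
  fixes K :: "'a::euclidean_space set"
  assumes dim: "DIM('a) > 2" and gr: "supporting_graph K k p \<nu>" and k: "k > 0"
    and x: "x \<in> K" "x \<noteq> p" "dist x p \<le> D" and z: "z \<in> K" "z \<noteq> p" "dist z p \<le> D"
    and law: "\<And>v. v \<bullet> \<nu> = 0 \<Longrightarrow> (sgn (x - p) + sgn (z - p)) \<bullet> v = 0"
    and max: "\<exists>\<epsilon>>0. \<forall>u\<in>frontier K. dist u p < \<epsilon> \<longrightarrow> dist x u + dist u z \<le> dist x p + dist p z"
  shows "1 / (2 * k * D) \<le> sgn (z - p) \<bullet> \<nu>"
proof (rule ccontr)
  assume neg: "\<not> ?thesis"
  define s where "s = sgn (z - p) \<bullet> \<nu>"
  have D: "D > 0" using x by (meson dist_pos_lt less_le_trans)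
  have n1: "norm \<nu> = 1" and half: "\<And>y. y \<in> K \<Longrightarrow> 0 \<le> (y - p) \<bullet> \<nu>"
    using gr by (auto simp: supporting_graph_def)
  have posx: "0 \<le> sgn (x - p) \<bullet> \<nu>" and posz: "0 \<le> sgn (z - p) \<bullet> \<nu>"
    using half[OF x(1)] half[OF z(1)] by (simp_all add: sgn_div_norm)
  have sx: "sgn (x - p) \<bullet> \<nu> = s" unfolding s_def
    by (rule reflected_unit_vector_same_height[OF _ _ n1 posx posz law])
       (use x z in \<open>simp_all add: norm_sgn\<close>)
  have "2 * k * D * s < 1"
    using neg D k by (simp add: s_def pos_less_divide_eq mult.commute not_le)
  have low: "2 * k * ((y - p) \<bullet> \<nu>) < 1" if "sgn (y - p) \<bullet> \<nu> = s" "dist y p \<le> D" for y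
  proof -
    have "(y - p) \<bullet> \<nu> = norm (y - p) * s"
      unfolding that(1)[symmetric] by (cases "y = p") (simp_all add: sgn_div_norm)
    also have "\<dots> \<le> D * s"
      using that(2) posz by (intro mult_right_mono) (auto simp: dist_norm s_def)
    finally have "2 * k * ((y - p) \<bullet> \<nu>) \<le> 2 * k * (D * s)" using k by simp
    then show ?thesis using \<open>2 * k * D * s < 1\<close> by (simp add: mult.assoc)
  qed
  obtain v where v: "v \<noteq> 0" "v \<bullet> \<nu> = 0" "v \<bullet> (x - p) = 0"
    using exists_nonzero_orthogonal_to_two[OF dim] by blast
  have "sgn (x - p) \<bullet> v = 0" using v(3) by (simp add: sgn_div_norm inner_commute)
  then have "sgn (z - p) \<bullet> v = 0" using law[OF v(2)] by (simp add: inner_add_left)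
  then have vz: "v \<bullet> (z - p) = 0" using z(2) by (simp add: sgn_div_norm inner_commute)
  obtain \<epsilon> where \<epsilon>: "\<epsilon> > 0"
    and mx: "\<And>u. u \<in> frontier K \<Longrightarrow> dist u p < \<epsilon> \<Longrightarrow> dist x u + dist u z \<le> dist x p + dist p z"
    using max by blast
  obtain \<delta> where \<delta>: "\<delta> > 0"
    and graph: "\<And>w. w \<bullet> \<nu> = 0 \<Longrightarrow> norm w < \<delta> \<Longrightarrow>
      \<exists>a. 0 \<le> a \<and> a \<le> k * (norm w)\<^sup>2 \<and> p + w + a *\<^sub>R \<nu> \<in> frontier K"
    using gr unfolding supporting_graph_def by blast
  \<comment> \<open>The displacement is at most \<open>t + a \<le> t + k t\<^sup>2 \<le> (1 + k) t\<close>, which has to be below \<open>\<epsilon>\<close>.\<close>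
  define t where "t = min (1 / 2) (min (\<delta> / 2) (\<epsilon> / (2 * (1 + k))))"
  define w where "w = (t / norm v) *\<^sub>R v"
  have t: "0 < t" "t \<le> 1 / 2" "t \<le> \<delta> / 2" "t \<le> \<epsilon> / (2 * (1 + k))"
    using \<delta> \<epsilon> k unfolding t_def by (simp, linarith+)
  have nw: "norm w = t" using v t by (simp add: w_def)
  have w: "w \<bullet> \<nu> = 0" "w \<bullet> (x - p) = 0" "w \<bullet> (z - p) = 0" "w \<noteq> 0"
    using v vz nw t by (auto simp: w_def)
  obtain a where a: "0 \<le> a" "a \<le> k * (norm w)\<^sup>2" and uF: "p + w + a *\<^sub>R \<nu> \<in> frontier K"
    using graph[OF w(1)] nw t \<delta> by auto
  have "dist (p + w + a *\<^sub>R \<nu>) p = norm (w + a *\<^sub>R \<nu>)"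
    by (simp add: dist_norm add.assoc)
  also have "\<dots> \<le> t + a" using a n1 nw by (intro norm_triangle_le) simp
  also have "\<dots> \<le> t + k * t"
  proof -
    have "t * t \<le> t" using t by (simp add: mult_left_le)
    then have "k * (t * t) \<le> k * t" using k by simp
    then show ?thesis using a(2) nw by (simp add: power2_eq_square)
  qed
  also have "\<dots> < \<epsilon>"
  proof -
    have "t * (2 * (1 + k)) \<le> \<epsilon>" using t(4) k by (simp add: pos_le_divide_eq)
    then show ?thesis using t(1) k \<epsilon> by (simp add: algebra_simps)
  qed
  finally have "dist x (p + w + a *\<^sub>R \<nu>) + dist (p + w + a *\<^sub>R \<nu>) z \<le> dist x p + dist p z"
    using mx[OF uF] by blast
  moreover have "dist x p < dist x (p + w + a *\<^sub>R \<nu>)"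
    using dist_increases_when_sliding_sideways[OF n1 w(1,2,4) a half[OF x(1)] low[OF sx x(3)]] .
  moreover have "dist z p < dist z (p + w + a *\<^sub>R \<nu>)"
    using dist_increases_when_sliding_sideways[OF n1 w(1,3,4) a half[OF z(1)] low[OF s_def[symmetric] z(3)]] .
  ultimately show False by (simp add: dist_commute)
qed

text \<open>Only the tangential part \<open>e - s \<nu>\<close> of the unit vector \<open>e\<close> along \<open>w\<close> contributes to the cosine of
  its angle with a tangent vector, and the norm of that part is \<open>sqrt (1 - s\<^sup>2) = cos (arcsin s)\<close>.
  The dimension guarantees that there is a nonzero tangent vector; the infimum over an empty set
  would be arbitrary.\<close>

lemma angle_to_hyperplane_ge_arcsin:
  fixes \<nu> w :: "'a::euclidean_space"
  assumes dim: "DIM('a) > 2" and n1: "norm \<nu> = 1" and w: "w \<noteq> 0" and s: "0 \<le> sgn w \<bullet> \<nu>"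
  shows "arcsin (sgn w \<bullet> \<nu>) \<le> angle_to_subspace w {v. v \<bullet> \<nu> = 0}"
  unfolding angle_to_subspace_def
proof (rule cINF_greatest)
  show "{v. v \<bullet> \<nu> = 0} - {0} \<noteq> {}"
    using exists_nonzero_orthogonal_to_two[OF dim, of \<nu> \<nu>] by auto
  fix v assume v: "v \<in> {v. v \<bullet> \<nu> = 0} - {0}"
  define e s where "e = sgn w" and "s = e \<bullet> \<nu>"
  have ne: "e \<bullet> e = 1" "\<nu> \<bullet> \<nu> = 1"
    using w n1 by (simp_all add: e_def dot_square_norm norm_sgn)
  have s1: "s \<le> 1" using norm_cauchy_schwarz[of e \<nu>] w n1 by (simp add: e_def s_def norm_sgn)
  have nt: "norm (e - s *\<^sub>R \<nu>) = sqrt (1 - s\<^sup>2)"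
    using ne unfolding norm_eq_sqrt_inner
    by (simp add: inner_diff_left inner_diff_right inner_commute s_def power2_eq_square)
  have eq: "(w \<bullet> v) / (norm w * norm v) = (e - s *\<^sub>R \<nu>) \<bullet> sgn v"
    using v by (simp add: e_def sgn_div_norm inner_diff_left inner_commute[of \<nu> v] divide_inverse)
  have "\<bar>(e - s *\<^sub>R \<nu>) \<bullet> sgn v\<bar> \<le> sqrt (1 - s\<^sup>2)"
    using Cauchy_Schwarz_ineq2[of "e - s *\<^sub>R \<nu>" "sgn v"] v nt by (simp add: norm_sgn)
  moreover have "sqrt (1 - s\<^sup>2) \<le> 1" by simp
  ultimately have "arccos (sqrt (1 - s\<^sup>2)) \<le> arccos ((w \<bullet> v) / (norm w * norm v))"
    unfolding eq by (intro arccos_le_arccos) linarith+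
  then show "arcsin (sgn w \<bullet> \<nu>) \<le> arccos ((w \<bullet> v) / (norm w * norm v))"
    using s s1 by (simp add: arcsin_arccos_sqrt_pos s_def e_def)
qed

section \<open>The lower bound for the angle of reflection\<close>

theorem theorem1p3:
  fixes K S :: "'a::euclidean_space set"
  assumes "DIM('a) > 2"
    and "strictly_convex_body K"
    and "S = frontier K"
    and "C2_hypersurface S"
    and "positively_curved K"
  shows "\<exists>C>0. \<forall>(I :: int set) (x :: int \<Rightarrow> 'a) (n :: int).
           maximizing_configuration S I x \<and> n - 1 \<in> I \<and> n \<in> I \<and> n + 1 \<in> I
           \<longrightarrow> reflection_angle S x n > C"
proof -
  have K: "compact K" "convex K" "interior K \<noteq> {}"
    using assms(2) by (auto simp: strictly_convex_body_def)
  have cK: "closed K" using K(1) compact_imp_closed by blast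
  have SK: "S \<subseteq> K" using frontier_subset_closed[OF cK] assms(3) by simp
  have "compact S" using K(1) assms(3) by (simp add: compact_frontier)
  from compact_C2_hypersurface_quadratically_flat[OF this assms(4)]
  obtain k where k: "k > 0" and flat: "\<And>p. p \<in> S \<Longrightarrow> \<exists>g. quadratically_flat S k p g"
    by blast
  define D where "D = diameter K + 1"
  have D: "D > 0" using diameter_ge_0[OF compact_imp_bounded[OF K(1)]] by (simp add: D_def)
  have dist_D: "dist a b \<le> D" if "a \<in> K" "b \<in> K" for a b
    using diameter_bounded_bound[OF compact_imp_bounded[OF K(1)] that] by (simp add: D_def)
  \<comment> \<open>The minimum with \<open>1\<close> keeps \<open>s0\<close> in the range of the sine. A supporting graph has the constant
    \<open>2 k\<close>, and half of \<open>arcsin s0\<close> makes the inequality strict.\<close>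
  define s0 where "s0 = min 1 (1 / (2 * (2 * k) * D))"
  have s0: "0 < s0" "s0 \<le> 1" using k D by (auto simp: s0_def)
  have "arcsin s0 > 0" using arcsin_less_arcsin[of 0 s0] s0 by simp
  have "arcsin s0 / 2 < reflection_angle S x n"
    if m: "maximizing_configuration S I x" and n: "n - 1 \<in> I" "n \<in> I" "n + 1 \<in> I" for I x n
  proof -
    define p where "p = x n"
    have bc: "billiard_configuration S I x" using m by (simp add: maximizing_configuration_def)
    have ne: "x (n - 1) \<noteq> p" "x (n + 1) \<noteq> p"
      using bc n unfolding billiard_configuration_def p_def
      by (metis diff_add_cancel, metis)
    have inS: "x (n - 1) \<in> S" "p \<in> S" "x (n + 1) \<in> S"
      using bc n by (auto simp: billiard_configuration_def p_def)
    have "{n-1..n+1} \<subseteq> I" using bc n by (auto simp: billiard_configuration_def)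
    then have crit: "critical_on S n n (Phi x n n) x"
      using bc by (auto simp: billiard_configuration_def)
    obtain g where "quadratically_flat (frontier K) k p g"
      using flat[OF inS(2)] assms(3) by blast
    then obtain \<nu> where gr: "supporting_graph K (2 * k) p \<nu>"
      using quadratically_flat_imp_supporting_graph[OF K(2) cK K(3) _ _ k] inS(2) assms(3) by blast
    have T: "tangent_space S p = {v. v \<bullet> \<nu> = 0}"
      using tangent_space_frontier_eq_normal_complement[OF cK _ gr] inS(2) assms(3) by simp
    have law: "(sgn (x (n - 1) - p) + sgn (x (n + 1) - p)) \<bullet> v = 0" if "v \<bullet> \<nu> = 0" for v
      using reflection_law[OF crit] ne that T by (simp add: p_def)
    have steep: "1 / (2 * (2 * k) * D) \<le> sgn (x (n + 1) - p) \<bullet> \<nu>"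
    proof (rule locally_longest_path_is_steep[OF assms(1) gr _ _ ne(1) _ _ ne(2) _ law])
      show "\<exists>\<epsilon>>0. \<forall>u\<in>frontier K. dist u p < \<epsilon> \<longrightarrow>
          dist (x (n - 1)) u + dist u (x (n + 1)) \<le> dist (x (n - 1)) p + dist p (x (n + 1))"
        using maximizing_configuration_vertex_maximal[OF m n] assms(3) by (simp add: p_def)
    qed (use k inS SK dist_D in auto)
    have n1: "norm \<nu> = 1" using gr by (simp add: supporting_graph_def)
    have s1: "s0 \<le> sgn (x (n + 1) - p) \<bullet> \<nu>" using steep by (simp add: s0_def)
    have "sgn (x (n + 1) - p) \<bullet> \<nu> \<le> 1"
      using norm_cauchy_schwarz[of "sgn (x (n + 1) - p)" \<nu>] ne n1 by (simp add: norm_sgn)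
    then have "arcsin s0 \<le> arcsin (sgn (x (n + 1) - p) \<bullet> \<nu>)"
      using s1 s0 by (intro arcsin_le_arcsin) auto
    also have "\<dots> \<le> angle_to_subspace (x (n + 1) - p) {v. v \<bullet> \<nu> = 0}"
      using angle_to_hyperplane_ge_arcsin[OF assms(1) n1] ne s1 s0 by simp
    finally show ?thesis
      using \<open>arcsin s0 > 0\<close> T by (simp add: reflection_angle_def p_def)
  qed
  then show ?thesis using \<open>arcsin s0 > 0\<close> by (intro exI[of _ "arcsin s0 / 2"]) auto
qed

end
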